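(* Let $C_n$ ($n\ge 3$) be the cycle on $n$ vertices. Then $\mathrm{ILN}(C_n) = O(\log n)$ as $n\to\infty$; that is, there exist constants $K>0$ and $n_0$ such that $\mathrm{ILN}(C_n)\le K\log n$ for all $n\ge n_0$.
   Context: Graphs are finite, simple and undirected. A valid labelling of a graph $G$ assigns to the vertices of $G$ pairwise distinct nonempty finite sets (labels) such that two distinct vertices are adjacent if and only if their labels are disjoint. The individual label number $\mathrm{ILN}(G)$ is the minimum, over all valid labellings of $G$, of the maximum cardinality of a vertex label. *)

theory Defs
  imports Complex_Main "Graph_Theory.Pair_Digraph"
begin

text \<open>
  Finite simple undirected graphs are the instances of \<^locale>\<open>pair_graph\<close>: finite, loop-free,
  with a symmetric set of arcs, so that \<open>u\<close> and \<open>v\<close> are adjacent iff \<open>(u, v) \<in> parcs G\<close>.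
\<close>

definition valid_labelling :: "'a pair_pre_digraph \<Rightarrow> ('a \<Rightarrow> 'b set) \<Rightarrow> bool" where
  "valid_labelling G L \<longleftrightarrow>
     (\<forall>v \<in> pverts G. finite (L v) \<and> L v \<noteq> {}) \<and>
     inj_on L (pverts G) \<and>
     (\<forall>u \<in> pverts G. \<forall>v \<in> pverts G. u \<noteq> v \<longrightarrow>
        ((u, v) \<in> parcs G \<longleftrightarrow> L u \<inter> L v = {}))"

definition max_label_size :: "'a pair_pre_digraph \<Rightarrow> ('a \<Rightarrow> 'b set) \<Rightarrow> nat" where
  "max_label_size G L = Max ((\<lambda>v. card (L v)) ` pverts G)"

text \<open>
  Labels may be taken to be sets of natural numbers, since a labelling of a finite graph uses
  only finitely many elements (lemma \<open>valid_labelling_nat\<close>). The minimum is over a nonempty set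
  for every graph (lemma \<open>valid_labelling_exists\<close>). For the graph without vertices, the value is
  the unspecified \<open>Max {}\<close>.
\<close>

definition ILN :: "'a pair_pre_digraph \<Rightarrow> nat" where
  "ILN G = (LEAST k. \<exists>L :: 'a \<Rightarrow> nat set. valid_labelling G L \<and> max_label_size G L = k)"

text \<open>
  This is the cycle on \<open>n\<close> vertices for \<open>n \<ge> 3\<close> only (for \<open>n = 1\<close> it has a loop, for \<open>n = 2\<close> it
  is a single edge).
\<close>

definition cycle_graph :: "nat \<Rightarrow> nat pair_pre_digraph" where
  "cycle_graph n =
     \<lparr> pverts = {..<n},
       parcs = {(i, j). i < n \<and> j < n \<and> (j = Suc i mod n \<or> i = Suc j mod n)} \<rparr>"

lemma pair_graph_cycle_graph:
  assumes "n \<ge> 3"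
  shows "pair_graph (cycle_graph n)"
proof
  show "finite (parcs (cycle_graph n))"
    by (rule finite_subset[of _ "{..<n} \<times> {..<n}"]) (auto simp: cycle_graph_def)
  show "symmetric (with_proj (cycle_graph n))"
    by (auto simp: symmetric_def cycle_graph_def sym_def)
  show "fst e \<noteq> snd e" if "e \<in> parcs (cycle_graph n)" for e
    using that assms by (auto simp: cycle_graph_def mod_Suc split: if_splits)
qed (auto simp: cycle_graph_def)

lemma valid_labelling_nat:
  fixes L :: "'a \<Rightarrow> 'b set"
  assumes "finite (pverts G)" and L: "valid_labelling G L"
  obtains L' :: "'a \<Rightarrow> nat set"
  where "valid_labelling G L'" and "max_label_size G L' = max_label_size G L"
proof -
  let ?U = "\<Union>v \<in> pverts G. L v"
  have "finite ?U"
    using assms by (auto simp: valid_labelling_def)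
  then obtain f :: "'b \<Rightarrow> nat" where f: "inj_on f ?U"
    by (metis finite_imp_inj_to_nat_seg)
  have img: "f ` L u = f ` L v \<longleftrightarrow> L u = L v" if "u \<in> pverts G" "v \<in> pverts G" for u v
    using that by (intro inj_on_image_eq_iff[OF f]) auto
  have disj: "f ` L u \<inter> f ` L v = f ` (L u \<inter> L v)" if "u \<in> pverts G" "v \<in> pverts G" for u v
    using that by (intro inj_on_image_Int[OF f, symmetric]) auto
  have "card (f ` L v) = card (L v)" if "v \<in> pverts G" for v
    using that by (intro card_image inj_on_subset[OF f]) auto
  then have "max_label_size G (\<lambda>v. f ` L v) = max_label_size G L"
    unfolding max_label_size_def by (simp cong: image_cong)
  moreover have "valid_labelling G (\<lambda>v. f ` L v)"
    using L unfolding valid_labelling_def inj_on_def by (simp add: img disj)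
  ultimately show thesis
    by (rule that[rotated])
qed

lemma valid_labelling_exists:
  fixes G :: "'a pair_pre_digraph"
  assumes "pair_graph G"
  obtains L :: "'a \<Rightarrow> nat set" where "valid_labelling G L"
proof -
  interpret pair_graph G by fact
  have sym: "(u, v) \<in> parcs G \<longleftrightarrow> (v, u) \<in> parcs G" for u v
    using pair_sym_arcs by (auto simp: symmetric_def sym_def)
  let ?L = "\<lambda>v. (\<lambda>u. {u, v}) ` {u \<in> pverts G. (u, v) \<notin> parcs G}"
  have self: "{v} \<in> ?L v" if "v \<in> pverts G" for v
    using that pair_no_loops[of "(v, v)"] by force
  have "finite (pverts G)"
    by (rule pair_finite_verts)
  moreover have "valid_labelling G ?L"
    unfolding valid_labelling_def
  proof (intro conjI ballI impI)
    show "inj_on ?L (pverts G)"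
    proof (rule inj_onI)
      fix u v assume "u \<in> pverts G" "v \<in> pverts G" "?L u = ?L v"
      then have "{u} \<in> ?L v" using self by blast
      then show "u = v" by auto
    qed
  next
    fix u v assume uv: "u \<in> pverts G" "v \<in> pverts G" "u \<noteq> v"
    have "{u, v} \<in> ?L u \<inter> ?L v" if "(u, v) \<notin> parcs G"
      using that uv sym[of u v] by (auto simp: insert_commute)
    moreover have "(u, v) \<notin> parcs G" if "x \<in> ?L u" "x \<in> ?L v" for x
    proof -
      from that uv have "x = {v, u}" "(v, u) \<notin> parcs G"
        by (auto simp: doubleton_eq_iff)
      then show ?thesis using sym[of u v] by blast
    qed
    ultimately show "(u, v) \<in> parcs G \<longleftrightarrow> ?L u \<inter> ?L v = {}"
      by blast
  qed (use self pair_finite_verts in auto)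
  ultimately show thesis
    using valid_labelling_nat that by blast
qed

end

theory Submission
  imports Defs
begin

text \<open>
  A family of independent sets covering all non-adjacent pairs yields a labelling: label a vertex by
  the members of the family containing it, together with its own singleton. For the cycle,
  \<open>O(log n)\<close> independent sets suffice. Two sets deal with the pairs containing the vertex \<open>n - 1\<close>,
  and the remaining vertices form a path. There, pairs of equal parity are covered by the even and
  the odd vertices. Every set \<open>A\<close> gives an independent set consisting of the \<open>2 x\<close> with \<open>x \<in> A\<close> and
  of the odd numbers with no such neighbour, and it covers \<open>{2 x, 2 y + 1}\<close> when \<open>x \<in> A\<close> and
  \<open>y, y + 1 \<notin> A\<close>. Binary digits provide such \<open>A\<close>: if \<open>s \<in> {0, 1}\<close> makes \<open>y + s\<close> even, then \<open>y\<close> and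
  \<open>y + 1\<close> agree under \<open>z \<mapsto> (z + s) div 2\<close>, but no other \<open>x\<close> has this value, so some binary digit
  separates \<open>x\<close> from both.
\<close>

lemma ILN_le:
  fixes L :: "'a \<Rightarrow> 'b set"
  assumes "finite (pverts G)" "pverts G \<noteq> {}" "valid_labelling G L"
    and "\<And>v. v \<in> pverts G \<Longrightarrow> card (L v) \<le> k"
  shows "ILN G \<le> k"
proof -
  obtain L' :: "'a \<Rightarrow> nat set"
    where "valid_labelling G L'" "max_label_size G L' = max_label_size G L"
    using valid_labelling_nat assms(1,3) by blast
  then have "ILN G \<le> max_label_size G L"
    unfolding ILN_def by (intro Least_le) blast
  also have "\<dots> \<le> k"
    using assms by (simp add: max_label_size_def)
  finally show ?thesis .
qed

lemma ILN_le_card_independent_cover: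
  fixes G :: "'a pair_pre_digraph"
  assumes "finite (pverts G)" "pverts G \<noteq> {}" "finite F"
    and indep: "\<And>S u v. S \<in> F \<Longrightarrow> u \<in> S \<Longrightarrow> v \<in> S \<Longrightarrow> (u, v) \<notin> parcs G"
    and cover: "\<And>u v. u \<in> pverts G \<Longrightarrow> v \<in> pverts G \<Longrightarrow> u \<noteq> v \<Longrightarrow> (u, v) \<notin> parcs G \<Longrightarrow>
      \<exists>S \<in> F. u \<in> S \<and> v \<in> S"
  shows "ILN G \<le> Suc (card F)"
proof -
  \<comment> \<open>Every element of \<open>L v\<close> is a set containing \<open>v\<close>. So a
    common element of \<open>L u\<close> and \<open>L v\<close> with \<open>u \<noteq> v\<close> is
    no singleton and lies in \<open>F\<close>, and \<open>{v}\<close> keeps labels nonempty and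
    distinct.\<close>
  define L where "L v = insert {v} {S \<in> F. v \<in> S}" for v
  have fin: "finite {S \<in> F. v \<in> S}" for v
    using \<open>finite F\<close> by simp
  have "inj L"
    unfolding L_def inj_def by blast
  moreover have "(u, v) \<in> parcs G \<longleftrightarrow> L u \<inter> L v = {}"
    if "u \<in> pverts G" "v \<in> pverts G" "u \<noteq> v" for u v
    using indep[of _ u v] cover[of u v] that unfolding L_def by blast
  ultimately have "valid_labelling G L"
    unfolding valid_labelling_def using fin by (auto simp: L_def intro: inj_on_subset)
  moreover have "card (L v) \<le> Suc (card F)" for v
    unfolding L_def using card_insert_le_m1[of "Suc (card F)"] card_mono[OF \<open>finite F\<close>, of "{S \<in> F. v \<in> S}"]
    by auto
  ultimately show ?thesis
    using ILN_le assms(1,2) by blast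
qed

lemma cycle_graph_arc_iff:
  assumes "n \<ge> 3"
  shows "(u, v) \<in> parcs (cycle_graph n) \<longleftrightarrow> u < n \<and> v < n \<and>
    (v = Suc u \<or> u = Suc v \<or> (u = 0 \<and> v = n - 1) \<or> (u = n - 1 \<and> v = 0))"
  using assms by (auto simp: cycle_graph_def mod_Suc split: if_splits)

definition path_independent :: "nat set \<Rightarrow> nat set" where
  "path_independent A =
     {x. if even x then x div 2 \<in> A else x div 2 \<notin> A \<and> Suc (x div 2) \<notin> A}"

lemma path_independent_Suc: "x \<in> path_independent A \<Longrightarrow> Suc x \<notin> path_independent A"
  by (cases "even x") (auto simp: path_independent_def elim!: evenE oddE)

lemma path_independent_UNIV: "path_independent UNIV = {x. even x}"
  and path_independent_empty: "path_independent {} = {x. odd x}"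
  by (auto simp: path_independent_def)

text \<open>\<open>j\<close> is the digit position, \<open>b\<close> the digit prescribed there and
  \<open>s\<close> the shift before halving, so each position accounts for at most four
  classes.\<close>

definition digit_class :: "nat \<times> bool \<times> bool \<Rightarrow> nat set" where
  "digit_class = (\<lambda>(j, b, s). {x. bit ((x + of_bool s) div 2) j = b})"

lemma digit_classes_separate:
  assumes "x < 2 ^ m" "y < 2 ^ m" "x \<noteq> y" "x \<noteq> Suc y"
  obtains j b s where "j < m" "x \<in> digit_class (j, b, s)"
    "y \<notin> digit_class (j, b, s)" "Suc y \<notin> digit_class (j, b, s)"
proof -
  define h where "h z = (z + of_bool (odd y)) div 2" for z :: nat
  have h: "h (Suc y) = h y" "h x \<noteq> h y"
    unfolding h_def using assms(3,4) by (cases "even y"; auto elim!: evenE oddE; presburger)+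
  \<comment> \<open>Even with the shift, \<open>h z \<le> z\<close>, so \<open>m\<close> digits
    still suffice.\<close>
  have small: "h z < 2 ^ m" if "z < 2 ^ m" for z
    using that by (cases "z = 0") (auto simp: h_def)
  obtain j where j: "j < m" "bit (h x) j \<noteq> bit (h y) j"
  proof -
    \<comment> \<open>Truncation to \<open>m\<close> digits changes neither value, which forces a
      difference at a position below \<open>m\<close>.\<close>
    have "take_bit m (h x) \<noteq> take_bit m (h y)"
      using h small assms(1,2) by (simp add: take_bit_nat_eq_self)
    then show thesis
      using that by (auto simp: bit_eq_iff bit_take_bit_iff)
  qed
  show thesis
    by (rule that[of j "bit (h x) j" "odd y"]) (use j h in \<open>auto simp: digit_class_def h_def\<close>)
qed

lemma path_independent_cover:
  assumes "u < n" "v < n" "n < 2 ^ m" "v \<noteq> u" "v \<noteq> Suc u" "u \<noteq> Suc v"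
  obtains A where "A \<in> {UNIV, {}} \<union> digit_class ` ({..<m} \<times> UNIV)"
    "u \<in> path_independent A" "v \<in> path_independent A"
proof -
  have opposite: "\<exists>A \<in> digit_class ` ({..<m} \<times> UNIV).
      a \<in> path_independent A \<and> c \<in> path_independent A"
    if "a < n" "c < n" "even a" "odd c" "c \<noteq> Suc a" "a \<noteq> Suc c" for a c
  proof -
    from that obtain x y where xy: "a = 2 * x" "c = 2 * y + 1"
      by (elim evenE oddE)
    have "x < 2 ^ m" "y < 2 ^ m" "x \<noteq> y" "x \<noteq> Suc y"
      using that xy \<open>n < 2 ^ m\<close> by linarith+
    then obtain j b s where "j < m" "x \<in> digit_class (j, b, s)"
      "y \<notin> digit_class (j, b, s)" "Suc y \<notin> digit_class (j, b, s)"
      by (rule digit_classes_separate)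
    then show ?thesis
      by (intro bexI[of _ "digit_class (j, b, s)"]) (auto simp: path_independent_def xy)
  qed
  consider "even u" "even v" | "odd u" "odd v" | "even u" "odd v" | "odd u" "even v"
    by blast
  then show thesis
  proof cases
    case 1
    then show thesis by (intro that[of UNIV]) (auto simp: path_independent_UNIV)
  next
    case 2
    then show thesis by (intro that[of "{}"]) (auto simp: path_independent_empty)
  next
    case 3
    then show thesis using opposite[of u v] assms that by blast
  next
    case 4
    then show thesis using opposite[of v u] assms that by blast
  qed
qed

lemma ILN_cycle_graph_le:
  assumes "n \<ge> 3" "n < 2 ^ m"
  shows "ILN (cycle_graph n) \<le> 4 * m + 5"
proof -
  define D where "D = digit_class ` ({..<m} \<times> UNIV)"
  \<comment> \<open>Deleting \<open>n - 1\<close> leaves a path, which removes the closing edge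
    between \<open>n - 1\<close> and \<open>0\<close>. The sets \<open>Q A\<close> contain
    \<open>n - 1\<close> and omit both its neighbours; the two parities already reach every other
    vertex.\<close>
  define P where "P A = path_independent A - {n - 1}" for A
  define Q where "Q A = insert (n - 1) (path_independent A - {0, n - 2})" for A
  let ?F = "P ` ({UNIV, {}} \<union> D) \<union> Q ` {UNIV, {}}"
  have D: "finite D" "card D \<le> 4 * m"
    using card_image_le[of "{..<m} \<times> (UNIV :: (bool \<times> bool) set)" digit_class]
    by (auto simp: D_def card_cartesian_product card_UNIV_bool simp flip: UNIV_Times_UNIV)
  \<comment> \<open>At most \<open>4 * m + 2\<close> sets come from \<open>P\<close> and two from
    \<open>Q\<close>; the singleton in each label later adds one.\<close>
  have "card ?F \<le> card (P ` ({UNIV, {}} \<union> D)) + card (Q ` {UNIV, {}})"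
    by (rule card_Un_le)
  also have "\<dots> \<le> card ({UNIV, {}} \<union> D) + card {UNIV, {} :: nat set}"
    by (intro add_mono card_image_le) (simp_all add: D)
  also have "\<dots> \<le> 4 * m + 4"
    using card_Un_le[of "{UNIV, {} :: nat set}" D] D by simp
  finally have card: "card ?F \<le> 4 * m + 4" .
  have indep_P: "(u, v) \<notin> parcs (cycle_graph n)" if "u \<in> P A" "v \<in> P A" for u v A
    using that path_independent_Suc[of _ A] assms(1) by (auto simp: P_def cycle_graph_arc_iff)
  have indep_Q: "(u, v) \<notin> parcs (cycle_graph n)" if "u \<in> Q A" "v \<in> Q A" for u v A
    using that path_independent_Suc[of _ A] assms(1) by (auto simp: Q_def cycle_graph_arc_iff)
  have last: "\<exists>S \<in> Q ` {UNIV, {}}. u \<in> S \<and> n - 1 \<in> S"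
    if "u < n" "(u, n - 1) \<notin> parcs (cycle_graph n)" for u
  proof -
    have "u \<noteq> 0" "u \<noteq> n - 2"
      using that assms(1) by (auto simp: cycle_graph_arc_iff)
    then show ?thesis
      by (auto simp: Q_def path_independent_UNIV path_independent_empty)
  qed
  have "ILN (cycle_graph n) \<le> Suc (card ?F)"
  proof (rule ILN_le_card_independent_cover)
    fix u v
    assume uv: "u \<in> pverts (cycle_graph n)" "v \<in> pverts (cycle_graph n)" "u \<noteq> v"
      "(u, v) \<notin> parcs (cycle_graph n)"
    then have "u < n" "v < n" "v \<noteq> Suc u" "u \<noteq> Suc v"
      using assms(1) by (auto simp: cycle_graph_arc_iff) (auto simp: cycle_graph_def)
    moreover have "(v, u) \<notin> parcs (cycle_graph n)"
      using uv(4) assms(1) by (auto simp: cycle_graph_arc_iff)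
    ultimately consider "u = n - 1" "\<exists>S \<in> Q ` {UNIV, {}}. v \<in> S \<and> u \<in> S"
      | "v = n - 1" "\<exists>S \<in> Q ` {UNIV, {}}. u \<in> S \<and> v \<in> S"
      | "u \<noteq> n - 1" "v \<noteq> n - 1"
      using last uv(4) by blast
    then show "\<exists>S \<in> ?F. u \<in> S \<and> v \<in> S"
    proof cases
      case 3
      obtain A where "A \<in> {UNIV, {}} \<union> D" "u \<in> path_independent A" "v \<in> path_independent A"
        unfolding D_def using path_independent_cover[of u n v m] \<open>u < n\<close> \<open>v < n\<close> assms(2) uv(3)
          \<open>v \<noteq> Suc u\<close> \<open>u \<noteq> Suc v\<close> by metis
      with 3 show ?thesis
        by (intro bexI[of _ "P A"]) (auto simp: P_def)
    qed blast+
  next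
    fix S u v assume "S \<in> ?F" "u \<in> S" "v \<in> S"
    then show "(u, v) \<notin> parcs (cycle_graph n)"
      using indep_P indep_Q by blast
  qed (use assms(1) D in \<open>auto simp: cycle_graph_def lessThan_empty_iff\<close>)
  with card show ?thesis by simp
qed

theorem theorem28:
  shows "\<exists>K > (0::real). \<exists>n0 \<ge> (3::nat). \<forall>n \<ge> n0. real (ILN (cycle_graph n)) \<le> K * ln (real n)"
\<comment> \<open>With \<open>m = k + 1\<close> the bound is \<open>4 * k + 9\<close>. Here
  \<open>k \<le> 2 * ln n\<close>, and \<open>1 \<le> ln n\<close> because \<open>n \<ge> 3\<close>
  exceeds e, so \<open>8 + 9 = 17\<close> works.\<close>
proof (intro exI[of _ "17::real"] exI[of _ "3::nat"] conjI allI impI)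
  fix n :: nat assume n: "n \<ge> 3"
  obtain k where k: "2 ^ k \<le> n" "n < 2 ^ (k + 1)"
    using ex_power_ivl1[of 2 n] n by auto
  have "real k * ln 2 = ln (real (2 ^ k))"
    by (simp add: ln_realpow)
  also have "\<dots> \<le> ln (real n)"
    using k(1) n by (subst ln_le_cancel_iff) (auto simp del: of_nat_power)
  finally have "real k * ln 2 \<le> ln (real n)" .
  \<comment> \<open>This is \<open>ln x \<le> x - 1\<close> at \<open>x = 1 / 2\<close>.\<close>
  moreover have "1 / 2 \<le> ln (2 :: real)"
    using ln_le_minus_one[of "1 / 2 :: real"] by (simp add: ln_div)
  then have "real k * (1 / 2) \<le> real k * ln 2"
    by (intro mult_left_mono) auto
  ultimately have "real k \<le> 2 * ln (real n)" by simp
  moreover have "1 \<le> ln (real n)"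
    using exp_le n by (subst ln_ge_iff) auto
  moreover have "real (ILN (cycle_graph n)) \<le> 4 * real k + 9"
    using of_nat_mono[OF ILN_cycle_graph_le[OF n k(2)], where 'a = real] by simp
  ultimately show "real (ILN (cycle_graph n)) \<le> 17 * ln (real n)"
    by linarith
qed simp_all

end
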